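(* Let $\boldsymbol{S}$ be a regular $m$-tier strip of length $n$ with associated poset $\mathcal{S}$, and let $K$ be a Kekulé structure of $\boldsymbol{S}$. Then there is exactly one strictly order-preserving map $\mu:\mathcal{A}_K\to\{1,\dots,n\}$ such that 1. $\mathrm{pos}_K(s_{k,j})=\mu(s_{k,j})+j$ for every $s_{k,j}\in\mathcal{A}_K$, and 2. $\mathrm{pos}_K(s_{k,j})=\max\left(\{\mu(s_{k',j'})\mid s_{k',j'}\in\mathcal{A}_K,\ s_{k',j'}<_{\mathcal{S}}s_{k,j}\}\cup\{0\}\right)+j$ for every $s_{k,j}\in\mathcal{S}\setminus\mathcal{A}_K$.
   Context: Geometry. Let $L$ be the infinite hexagonal lattice, drawn so that some of its edges are vertical. A benzenoid is a finite subgraph of $L$ consisting of all vertices and edges lying on or inside a cycle of $L$. A regular 1-tier strip of length $n$ consists of $n$ adjacent hexagons in the same horizontal row of $L$. A regular $m$-tier strip $\boldsymbol{S}$ of length $n$ is obtained by merging $m$ consecutive regular 1-tier strips located in adjacent rows of $L$ (numbered $1,\dots,m$ from top to bottom) such that (i) adjacent strips differ at each end (left and right) by $\pm\frac12$ hexagon unit, and (ii) the top and bottom 1-tier strips both have length $n$. Interfaces and fragments. For $k=1,\dots,m$ the interface $i_k$ is the set of vertical edges of the hexagons in row $k$; its edges are numbered from left to right as $e_{k,1},e_{k,2},\dots$; put $i_0=i_{m+1}=\varnothing$. The fragment $f_k$ ($1\le k\le m+1$) is the set of edges (and vertices) lying at least partially between the horizontal lines $P_{k-1}$ and $P_k$,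 where $P_k$ ($1\le k\le m$) is the horizontal line through the midpoints of the edges of $i_k$, $P_0$ lies above $\boldsymbol{S}$ and $P_{m+1}$ below $\boldsymbol{S}$. The interface bonds of $f_k$ are the elements of $i_{k-1}\cup i_k$, ordered from left to right by horizontal position; the first one is the leftmost. Kekulé structures. A Kekulé structure $K$ of $\boldsymbol{S}$ is a perfect matching; $K_I=E(K)\cap\bigcup_{k=1}^m i_k$ is its set of double interface bonds. Put $\mathrm{ord}(i_k)=|i_k|-n$. It is known that $|K_I\cap i_k|=\mathrm{ord}(i_k)$ for every Kekulé structure $K$; let $d_{k,j}^K$ be the $j$-th element of $K_I\cap i_k$ from the left. A proper sextet of $K$ is a hexagon of $\boldsymbol{S}$ whose right vertical edge, upper-left slanted edge and lower-left slanted edge all belong to $K$; these three edges participate in the proper sextet. Poset $\mathcal{S}$. $\mathcal{S}=\{s_{k,j}: 1\le k\le m,\ 1\le j\le \mathrm{ord}(i_k)\}$ with strict order $<_{\mathcal{S}}$ generated (by transitive closure) by the cover relations: $s_{k,j}\lessdot_{\mathcal{S}}s_{k',j'}$ if and only if $|k'-k|=1$ and, with $\kappa=\max(k,k')$, $j'-j=0$ when the first interface bond of $f_\kappa$ belongs to $i_k$, and $j'-j=1$ when the first interface bond of $f_\kappa$ belongs to $i_{k'}$. Maps attached to $K$. $\tau_K:\mathcal{S}\to K_I$ is $\tau_K(s_{k,j})=d_{k,j}^K$; $\mathrm{pos}_K(s_{k,j})$ is the number such that $\tau_K(s_{k,j})=e_{k,\mathrm{pos}_K(s_{k,j})}$.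 $\mathcal{A}_K$ is the induced subposet of $\mathcal{S}$ consisting of the $s_{k,j}$ for which $\tau_K(s_{k,j})$ participates in a proper sextet of $K$. A map $\mu$ from a poset to the integers is strictly order-preserving if $s<t\Rightarrow\mu(s)<\mu(t)$. *)

theory Defs
  imports Main "HOL-Library.FuncSet"
begin

text \<open>
  The hexagonal lattice \<open>L\<close> in brick-wall coordinates.  A vertex is a pair \<open>(x, y)\<close>: \<open>y\<close> numbers the
  horizontal zigzag paths of \<open>L\<close> from top to bottom, and \<open>x\<close> is the horizontal position in units of
  half a hexagon.  Consecutive vertices of a zigzag are joined by a slanted edge; a vertical
  edge leads from \<open>(x, y)\<close> down to \<open>(x, y + 1)\<close> precisely when \<open>x + y\<close> is even.
  Row \<open>k\<close> of hexagons lies between the zigzags \<open>k\<close> and \<open>k + 1\<close>; the hexagon of row \<open>k\<close> whose centre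
  has horizontal position \<open>x\<close> is denoted \<open>(x, k)\<close>, and it exists precisely when \<open>x + k\<close> is odd.
\<close>

type_synonym vertex = "int \<times> int"
type_synonym edge = "vertex set"
type_synonym hexagon = "int \<times> int"

definition vertical :: "int \<Rightarrow> int \<Rightarrow> edge" where
  "vertical x y = {(x, y), (x, y + 1)}"

definition slanted :: "int \<Rightarrow> int \<Rightarrow> edge" where
  "slanted x y = {(x, y), (x + 1, y)}"

definition lattice_edges :: "edge set" where
  "lattice_edges = {slanted x y | x y. True} \<union> {vertical x y | x y. even (x + y)}"

definition lattice_hexagons :: "hexagon set" where
  "lattice_hexagons = {(x, k). odd (x + k)}"

fun left_edge :: "hexagon \<Rightarrow> edge" where
  "left_edge (x, k) = vertical (x - 1) k"

fun right_edge :: "hexagon \<Rightarrow> edge" where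
  "right_edge (x, k) = vertical (x + 1) k"

fun upper_left_edge :: "hexagon \<Rightarrow> edge" where
  "upper_left_edge (x, k) = slanted (x - 1) k"

fun upper_right_edge :: "hexagon \<Rightarrow> edge" where
  "upper_right_edge (x, k) = slanted x k"

fun lower_left_edge :: "hexagon \<Rightarrow> edge" where
  "lower_left_edge (x, k) = slanted (x - 1) (k + 1)"

fun lower_right_edge :: "hexagon \<Rightarrow> edge" where
  "lower_right_edge (x, k) = slanted x (k + 1)"

definition hexagon_edges :: "hexagon \<Rightarrow> edge set" where
  "hexagon_edges h =
     {left_edge h, right_edge h, upper_left_edge h, upper_right_edge h,
      lower_left_edge h, lower_right_edge h}"

lemma hexagon_edges_subset_lattice:
  "h \<in> lattice_hexagons \<Longrightarrow> hexagon_edges h \<subseteq> lattice_edges"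
proof (cases h)
  case (Pair x k)
  assume "h \<in> lattice_hexagons"
  then have "even ((x - 1) + k)" "even ((x + 1) + k)"
    using Pair by (auto simp: lattice_hexagons_def)
  then have "vertical (x - 1) k \<in> lattice_edges" "vertical (x + 1) k \<in> lattice_edges"
    unfolding lattice_edges_def by blast+
  moreover have "slanted u v \<in> lattice_edges" for u v
    unfolding lattice_edges_def by blast
  ultimately show ?thesis
    using Pair by (simp add: hexagon_edges_def)
qed

text \<open>
  A benzenoid is represented by the set of its hexagons; as a graph it consists of their edges
  and vertices.
\<close>

definition edges_of :: "hexagon set \<Rightarrow> edge set" where
  "edges_of S = (\<Union>h\<in>S. hexagon_edges h)"

definition vertices_of :: "hexagon set \<Rightarrow> vertex set" where
  "vertices_of S = \<Union> (edges_of S)"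

definition one_tier_strip :: "int \<Rightarrow> int \<Rightarrow> nat \<Rightarrow> hexagon set" where
  "one_tier_strip x k n = {(x + 2 * int i, k) | i. i < n}"

text \<open>
  In row \<open>k\<close>, \<open>a k\<close> is the centre of the leftmost hexagon and \<open>len k\<close> the number of hexagons; the
  left and right ends of the row are at \<open>a k - 1\<close> and \<open>a k + 2 * len k - 1\<close>.  Half a hexagon
  unit is \<open>1\<close> in the present coordinates.  The rows of \<open>L\<close> are numbered so that the strip occupies
  the rows \<open>1, \<dots>, m\<close>.
\<close>

definition regular_strip :: "nat \<Rightarrow> nat \<Rightarrow> hexagon set \<Rightarrow> bool" where
  "regular_strip m n S \<longleftrightarrow> 1 \<le> m \<and>
     (\<exists>(a :: nat \<Rightarrow> int) (len :: nat \<Rightarrow> nat).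
        S = (\<Union>k\<in>{1..m}. one_tier_strip (a k) (int k) (len k)) \<and>
        S \<subseteq> lattice_hexagons \<and>
        (\<forall>k\<in>{1..m}. 1 \<le> len k) \<and>
        (\<forall>k\<in>{1..<m}.
           \<bar>(a (k + 1) - 1) - (a k - 1)\<bar> = 1 \<and>
           \<bar>(a (k + 1) + 2 * int (len (k + 1)) - 1) - (a k + 2 * int (len k) - 1)\<bar> = 1) \<and>
        len 1 = n \<and> len m = n)"

definition interface :: "hexagon set \<Rightarrow> int \<Rightarrow> edge set" where
  "interface S k = (\<Union>h\<in>{h \<in> S. snd h = k}. {left_edge h, right_edge h})"

definition interface_bonds :: "hexagon set \<Rightarrow> int \<Rightarrow> edge set" where
  "interface_bonds S k = interface S (k - 1) \<union> interface S k"

text \<open>Twice the horizontal position of the midpoint of an edge.\<close>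

definition hpos :: "edge \<Rightarrow> int" where
  "hpos e = (\<Sum>v\<in>e. fst v)"

text \<open>
  The \<open>q\<close>-th element (counted from \<open>1\<close>) from the left of a finite set \<open>E\<close> of edges with pairwise
  different horizontal positions; unspecified unless \<open>1 \<le> q \<le> card E\<close>.
\<close>

definition nth_from_left :: "edge set \<Rightarrow> nat \<Rightarrow> edge" where
  "nth_from_left E q = (THE e. e \<in> E \<and> card {e' \<in> E. hpos e' \<le> hpos e} = q)"

definition interface_edge :: "hexagon set \<Rightarrow> int \<Rightarrow> nat \<Rightarrow> edge" where
  "interface_edge S k q = nth_from_left (interface S k) q"

definition ord_interface :: "nat \<Rightarrow> hexagon set \<Rightarrow> int \<Rightarrow> int" where
  "ord_interface n S k = int (card (interface S k)) - int n"

definition kekule_structure :: "hexagon set \<Rightarrow> edge set \<Rightarrow> bool" where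
  "kekule_structure S K \<longleftrightarrow>
     K \<subseteq> edges_of S \<and> (\<forall>v\<in>vertices_of S. \<exists>!e. e \<in> K \<and> v \<in> e)"

definition double_interface_bonds :: "nat \<Rightarrow> hexagon set \<Rightarrow> edge set \<Rightarrow> edge set" where
  "double_interface_bonds m S K = K \<inter> (\<Union>k\<in>{1..int m}. interface S k)"

definition proper_sextet :: "hexagon set \<Rightarrow> edge set \<Rightarrow> hexagon \<Rightarrow> bool" where
  "proper_sextet S K h \<longleftrightarrow>
     h \<in> S \<and> right_edge h \<in> K \<and> upper_left_edge h \<in> K \<and> lower_left_edge h \<in> K"

definition participates_in_proper_sextet :: "hexagon set \<Rightarrow> edge set \<Rightarrow> edge \<Rightarrow> bool" where
  "participates_in_proper_sextet S K e \<longleftrightarrow>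
     (\<exists>h. proper_sextet S K h \<and> e \<in> {right_edge h, upper_left_edge h, lower_left_edge h})"

text \<open>The pair \<open>(k, j)\<close> stands for the element \<open>s\<^sub>k\<^sub>,\<^sub>j\<close>.\<close>

definition strip_poset :: "nat \<Rightarrow> nat \<Rightarrow> hexagon set \<Rightarrow> (int \<times> nat) set" where
  "strip_poset m n S =
     {(k, j). 1 \<le> k \<and> k \<le> int m \<and> 1 \<le> j \<and> int j \<le> ord_interface n S k}"

definition strip_cover ::
    "nat \<Rightarrow> nat \<Rightarrow> hexagon set \<Rightarrow> ((int \<times> nat) \<times> (int \<times> nat)) set" where
  "strip_cover m n S =
     {((k, j), (k', j')).
        (k, j) \<in> strip_poset m n S \<and> (k', j') \<in> strip_poset m n S \<and> \<bar>k' - k\<bar> = 1 \<and>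
        (let b = nth_from_left (interface_bonds S (max k k')) 1
         in (b \<in> interface S k \<longrightarrow> int j' - int j = 0) \<and>
            (b \<in> interface S k' \<longrightarrow> int j' - int j = 1))}"

definition strip_less ::
    "nat \<Rightarrow> nat \<Rightarrow> hexagon set \<Rightarrow> ((int \<times> nat) \<times> (int \<times> nat)) set" where
  "strip_less m n S = (strip_cover m n S)\<^sup>+"

fun tau :: "nat \<Rightarrow> hexagon set \<Rightarrow> edge set \<Rightarrow> int \<times> nat \<Rightarrow> edge" where
  "tau m S K (k, j) = nth_from_left (double_interface_bonds m S K \<inter> interface S k) j"

fun pos :: "nat \<Rightarrow> hexagon set \<Rightarrow> edge set \<Rightarrow> int \<times> nat \<Rightarrow> nat" where
  "pos m S K (k, j) =
     (THE q. q \<in> {1..card (interface S k)} \<and> tau m S K (k, j) = interface_edge S k q)"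

definition sextet_poset ::
    "nat \<Rightarrow> nat \<Rightarrow> hexagon set \<Rightarrow> edge set \<Rightarrow> (int \<times> nat) set" where
  "sextet_poset m n S K =
     {s \<in> strip_poset m n S. participates_in_proper_sextet S K (tau m S K s)}"

end

theory Submission
  imports Defs
begin

text \<open>
  Condition 1 leaves no choice: on \<open>\<A>\<^sub>K\<close> the map has to be \<open>shift s\<^sub>k\<^sub>,\<^sub>j = pos s\<^sub>k\<^sub>,\<^sub>j - j\<close>, the
  number of single bonds of the interface to the left of the double bond \<open>d\<^sub>k\<^sub>,\<^sub>j\<close>.  What has to be
  shown is that this quantity behaves as required on the whole poset.

  The vertices of a zigzag form a path, and their vertical lattice edges lead up and down in
  alternation; on the top and bottom zigzag, those that leave the strip count as never double.
  A perfect matching pairs the vertices that are not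
  covered by double interface bonds along the path, so there is an even number of them between
  two consecutive double bonds; hence the double bonds of a fragment also alternate between its
  two interfaces, starting with the interface that contains the first bond (\<open>fragment_balance\<close>).
  Two consequences follow.  The number of double bonds changes from row to row like the number of
  hexagons, so it equals \<open>ord\<close> (\<open>card_bonds\<close>).  And \<open>s \<lessdot> t\<close> holds exactly when the bond of \<open>t\<close>
  is the immediate successor of the bond of \<open>s\<close> in the left-to-right order of a fragment
  (\<open>count_neighbour_row\<close>, \<open>cover_predecessor\<close>).

  Let \<open>place s\<close> be the horizontal coordinate of the bond of \<open>s\<close>.  For a cover \<open>s \<lessdot> t\<close> one computes
  \<open>2 (shift t - shift s) = place t - place s - 1\<close> (\<open>cover_step\<close>).  So \<open>shift\<close> is weakly increasing,
  and it is constant on a cover exactly when the two bonds are half a hexagon apart.  A double bond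
  that is not at the left end of its row fails to close a proper sextet exactly when there is such
  a double bond half a hexagon to its left in an adjacent row (\<open>sextet_poset_iff\<close>).  Therefore
  \<open>shift\<close> increases strictly into elements of \<open>\<A>\<^sub>K\<close>; and from an element outside \<open>\<A>\<^sub>K\<close> one can
  walk down covers without changing \<open>shift\<close>, until either an element of \<open>\<A>\<^sub>K\<close> is reached or the
  left end of a row, where \<open>shift\<close> is \<open>0\<close> (\<open>nonsextet_shift_attained\<close>).  This is the maximum
  formula of Condition 2.
\<close>

section \<open>Ranks in finite sets of edges\<close>

lemma rank_bij_betw:
  fixes h :: "'a \<Rightarrow> 'b :: linorder"
  assumes fin: "finite E" and inj: "inj_on h E"
  shows "bij_betw (\<lambda>e. card {e' \<in> E. h e' \<le> h e}) E {1..card E}"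
proof -
  let ?rank = "\<lambda>e. card {e' \<in> E. h e' \<le> h e}"
  have less: "?rank e < ?rank f" if "e \<in> E" "f \<in> E" "h e < h f" for e f
    by (rule psubset_card_mono) (use that fin in \<open>auto dest: leD\<close>)
  have rank_inj: "inj_on ?rank E"
  proof (rule inj_onI)
    fix e f assume "e \<in> E" "f \<in> E" "?rank e = ?rank f"
    with less[of e f] less[of f e] have "h e = h f"
      by (metis less_irrefl linorder_neqE)
    with inj \<open>e \<in> E\<close> \<open>f \<in> E\<close> show "e = f" by (auto dest: inj_onD)
  qed
  have "?rank ` E \<subseteq> {1..card E}"
  proof
    fix q assume "q \<in> ?rank ` E"
    then obtain e where e: "e \<in> E" "q = ?rank e" by blast
    have "?rank e > 0" using e fin by (auto simp: card_gt_0_iff)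
    moreover have "?rank e \<le> card E" using fin by (auto intro: card_mono)
    ultimately show "q \<in> {1..card E}" using e by auto
  qed
  moreover have "card (?rank ` E) = card {1..card E}"
    using rank_inj by (simp add: card_image)
  ultimately have "?rank ` E = {1..card E}"
    by (simp add: card_subset_eq)
  with rank_inj show ?thesis by (simp add: bij_betw_def)
qed

lemma nth_from_left_rank:
  assumes "finite E" "inj_on hpos E" "e \<in> E"
  shows "nth_from_left E (card {e' \<in> E. hpos e' \<le> hpos e}) = e"
  unfolding nth_from_left_def
proof (rule the_equality)
  show "e \<in> E \<and> card {e' \<in> E. hpos e' \<le> hpos e} = card {e' \<in> E. hpos e' \<le> hpos e}"
    using assms by simp
  fix f assume "f \<in> E \<and> card {e' \<in> E. hpos e' \<le> hpos f} = card {e' \<in> E. hpos e' \<le> hpos e}"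
  then show "f = e"
    using rank_bij_betw[OF assms(1,2)] assms(3) by (auto simp: bij_betw_def dest: inj_onD)
qed

lemma nth_from_left_in:
  assumes "finite E" "inj_on hpos E" "1 \<le> q" "q \<le> card E"
  shows "nth_from_left E q \<in> E"
    and "card {e' \<in> E. hpos e' \<le> hpos (nth_from_left E q)} = q"
proof -
  have "q \<in> (\<lambda>e. card {e' \<in> E. hpos e' \<le> hpos e}) ` E"
    using rank_bij_betw[OF assms(1,2)] assms(3,4) by (auto simp: bij_betw_def)
  then obtain e where e: "e \<in> E" "q = card {e' \<in> E. hpos e' \<le> hpos e}" by blast
  with nth_from_left_rank[OF assms(1,2)] have "nth_from_left E q = e" by simp
  with e show "nth_from_left E q \<in> E" "card {e' \<in> E. hpos e' \<le> hpos (nth_from_left E q)} = q"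
    by simp_all
qed

section \<open>Vertical and slanted edges\<close>

lemma vertical_eq_iff: "vertical x y = vertical x' y' \<longleftrightarrow> x = x' \<and> y = y'"
  by (auto simp: vertical_def doubleton_eq_iff)

lemma slanted_eq_iff: "slanted x y = slanted x' y' \<longleftrightarrow> x = x' \<and> y = y'"
  by (auto simp: slanted_def doubleton_eq_iff)

lemma vertical_neq_slanted: "vertical x y \<noteq> slanted x' y'"
  by (auto simp: vertical_def slanted_def doubleton_eq_iff)

lemmas edge_eq_simps =
  vertical_eq_iff slanted_eq_iff vertical_neq_slanted vertical_neq_slanted[symmetric]

lemma mem_vertical_iff: "(x, y) \<in> vertical x' y' \<longleftrightarrow> x = x' \<and> (y = y' \<or> y - 1 = y')"
  by (auto simp: vertical_def)

lemma mem_slanted_iff: "(x, y) \<in> slanted x' y' \<longleftrightarrow> y = y' \<and> (x = x' \<or> x - 1 = x')"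
  by (auto simp: slanted_def)

lemma hpos_vertical: "hpos (vertical x y) = 2 * x"
  by (simp add: hpos_def vertical_def)

section \<open>A strip with a perfect matching\<close>

text \<open>
  The interface in row \<open>k\<close> extends from \<open>l k\<close> to \<open>r k\<close>.  The fictitious rows \<open>0\<close> and \<open>m + 1\<close>, which
  contain no hexagon, are given ends half a hexagon inside the ends of the first and the last row.
  With this convention the top and bottom zigzags obey the same rules as the inner ones: their
  first bond belongs to the real row, and the length \<open>n - 1\<close> of row \<open>0\<close> corresponds to
  \<open>ord = 0\<close>, which starts the induction over the rows.
\<close>

locale strip_matching =
  fixes m n :: nat and S :: "hexagon set" and K :: "edge set" and l r :: "int \<Rightarrow> int"
  assumes hexagon_iff:
      "(x, k) \<in> S \<longleftrightarrow> 1 \<le> k \<and> k \<le> int m \<and> l k < x \<and> x < r k \<and> odd (x + k)"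
    and even_l: "0 \<le> k \<Longrightarrow> k \<le> int m + 1 \<Longrightarrow> even (l k + k)"
    and even_r: "0 \<le> k \<Longrightarrow> k \<le> int m + 1 \<Longrightarrow> even (r k + k)"
    and l_less_r: "1 \<le> k \<Longrightarrow> k \<le> int m \<Longrightarrow> l k < r k"
    and l_step: "0 \<le> k \<Longrightarrow> k \<le> int m \<Longrightarrow> \<bar>l (k + 1) - l k\<bar> = 1"
    and r_step: "0 \<le> k \<Longrightarrow> k \<le> int m \<Longrightarrow> \<bar>r (k + 1) - r k\<bar> = 1"
    and row_0: "r 0 - l 0 = 2 * int n - 2" "l 1 < l 0" "r 0 < r 1"
    and row_last: "l (int m) < l (int m + 1)" "r (int m + 1) < r (int m)"
    and kekule: "kekule_structure S K"
begin

definition bonds :: "int \<Rightarrow> int set" where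
  "bonds k = {x. vertical x k \<in> K}"

definition count :: "int \<Rightarrow> int \<Rightarrow> int" where
  "count k x = int (card {y \<in> bonds k. y \<le> x})"

text \<open>
  The ends of zigzag \<open>k\<close>, which forms the lower border of row \<open>k - 1\<close> and the upper border of
  row \<open>k\<close>.
\<close>

definition left_end :: "int \<Rightarrow> int" where
  "left_end k = min (l (k - 1)) (l k)"

definition right_end :: "int \<Rightarrow> int" where
  "right_end k = max (r (k - 1)) (r k)"

lemma interface_eq:
  assumes "1 \<le> k" "k \<le> int m"
  shows "interface S k = (\<lambda>x. vertical x k) ` {x. l k \<le> x \<and> x \<le> r k \<and> even (x + k)}"
proof -
  have "e \<in> interface S k \<longleftrightarrow> (\<exists>x. (x, k) \<in> S \<and> (e = vertical (x - 1) k \<or> e = vertical (x + 1) k))" for e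
    by (auto simp: interface_def)
  moreover have "(x, k) \<in> S \<longleftrightarrow> l k < x \<and> x < r k \<and> odd (x + k)" for x
    using assms by (simp add: hexagon_iff)
  moreover have "(\<exists>x. (l k < x \<and> x < r k \<and> odd (x + k)) \<and> (y = x - 1 \<or> y = x + 1))
      \<longleftrightarrow> l k \<le> y \<and> y \<le> r k \<and> even (y + k)" (is "?L \<longleftrightarrow> ?R") for y
  proof
    assume ?L then show ?R by auto
  next
    assume R: ?R
    show ?L
    proof (cases "y = l k")
      case True
      moreover have "r k \<noteq> l k + 1" using even_l[of k] even_r[of k] assms by auto
      ultimately have "l k < y + 1 \<and> y + 1 < r k \<and> odd (y + 1 + k)"
        using R l_less_r[OF assms] by auto
      then show ?thesis by (intro exI[of _ "y + 1"]) simp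
    next
      case False
      moreover have "y \<noteq> l k + 1" using R even_l[of k] assms by auto
      ultimately have "l k < y - 1 \<and> y - 1 < r k \<and> odd (y - 1 + k)"
        using R by auto
      then show ?thesis by (intro exI[of _ "y - 1"]) simp
    qed
  qed
  ultimately have "e \<in> interface S k
      \<longleftrightarrow> (\<exists>x. l k \<le> x \<and> x \<le> r k \<and> even (x + k) \<and> e = vertical x k)" for e
    by metis
  then show ?thesis by (auto simp: image_iff)
qed

lemma m_pos: "0 < m"
proof (rule ccontr)
  assume "\<not> 0 < m"
  then show False using row_0 row_last by simp
qed

lemma edges_of_cases:
  assumes "e \<in> edges_of S"
  obtains (vertical) x k where "e = vertical x k" "1 \<le> k" "k \<le> int m" "l k \<le> x" "x \<le> r k"
      "even (x + k)"
    | (slanted) x k where "e = slanted x k" "1 \<le> k" "k \<le> int m + 1" "left_end k \<le> x"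
      "x + 1 \<le> right_end k"
proof -
  from assms obtain x k where S: "(x, k) \<in> S" and e: "e \<in> hexagon_edges (x, k)"
    by (auto simp: edges_of_def)
  have h: "1 \<le> k" "k \<le> int m" "l k < x" "x < r k" "odd (x + k)"
    using S by (auto simp: hexagon_iff)
  from e consider "e = vertical (x - 1) k" | "e = vertical (x + 1) k" | "e = slanted (x - 1) k"
    | "e = slanted x k" | "e = slanted (x - 1) (k + 1)" | "e = slanted x (k + 1)"
    by (auto simp: hexagon_edges_def)
  then show thesis
  proof cases
    case 1 then show thesis using h by (intro vertical[of "x - 1" k]) auto
  next
    case 2 then show thesis using h by (intro vertical[of "x + 1" k]) auto
  next
    case 3 then show thesis using h
      by (intro slanted[of "x - 1" k]) (auto simp: left_end_def right_end_def)
  next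
    case 4 then show thesis using h
      by (intro slanted[of "x" k]) (auto simp: left_end_def right_end_def)
  next
    case 5 then show thesis using h
      by (intro slanted[of "x - 1" "k + 1"]) (auto simp: left_end_def right_end_def)
  next
    case 6 then show thesis using h
      by (intro slanted[of "x" "k + 1"]) (auto simp: left_end_def right_end_def)
  qed
qed

lemma K_subset: "K \<subseteq> edges_of S"
  using kekule by (simp add: kekule_structure_def)

lemma bondsD:
  assumes "x \<in> bonds k"
  shows "1 \<le> k" "k \<le> int m" "l k \<le> x" "x \<le> r k" "even (x + k)"
proof -
  have "vertical x k \<in> edges_of S" using assms K_subset by (auto simp: bonds_def)
  then show "1 \<le> k" "k \<le> int m" "l k \<le> x" "x \<le> r k" "even (x + k)"
    by (cases rule: edges_of_cases; auto simp: edge_eq_simps)+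
qed

lemma slanted_in_K_D:
  assumes "slanted x k \<in> K"
  shows "1 \<le> k" "k \<le> int m + 1" "left_end k \<le> x" "x + 1 \<le> right_end k"
proof -
  have "slanted x k \<in> edges_of S" using assms K_subset by auto
  then show "1 \<le> k" "k \<le> int m + 1" "left_end k \<le> x" "x + 1 \<le> right_end k"
    by (cases rule: edges_of_cases; auto simp: edge_eq_simps)+
qed

lemma row_vertex:
  assumes "1 \<le> k" "k \<le> int m" "l k \<le> x" "x \<le> r k"
  shows "(x, k) \<in> vertices_of S" "(x, k + 1) \<in> vertices_of S"
proof -
  have *: "(x, k) \<in> vertices_of S \<and> (x, k + 1) \<in> vertices_of S"
    if "(y, k) \<in> S" "\<bar>y - x\<bar> \<le> 1" for y
  proof -
    have "hexagon_edges (y, k) \<subseteq> edges_of S" using that by (auto simp: edges_of_def)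
    then have "slanted (y - 1) k \<in> edges_of S" "slanted y k \<in> edges_of S"
      "slanted (y - 1) (k + 1) \<in> edges_of S" "slanted y (k + 1) \<in> edges_of S"
      by (auto simp: hexagon_edges_def)
    then have "slanted (y - 1) k \<union> slanted y k \<subseteq> vertices_of S"
      "slanted (y - 1) (k + 1) \<union> slanted y (k + 1) \<subseteq> vertices_of S"
      unfolding vertices_of_def by blast+
    moreover have "x = y - 1 \<or> x = y \<or> x = y + 1" using that by linarith
    ultimately show ?thesis by (auto simp: slanted_def)
  qed
  have "r k \<noteq> l k + 1" using even_l[of k] even_r[of k] assms by auto
  with l_less_r[OF assms(1,2)] have "l k + 2 \<le> r k" by linarith
  have "\<exists>y. (y, k) \<in> S \<and> \<bar>y - x\<bar> \<le> 1"
  proof (cases "odd (x + k)")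
    case True
    then have "x \<noteq> l k" "x \<noteq> r k" using even_l[of k] even_r[of k] assms by auto
    with True show ?thesis using assms by (intro exI[of _ x]) (auto simp: hexagon_iff)
  next
    case False
    show ?thesis
    proof (cases "x = l k")
      case True
      with False \<open>l k + 2 \<le> r k\<close> show ?thesis using assms
        by (intro exI[of _ "x + 1"]) (auto simp: hexagon_iff)
    next
      case False': False
      moreover have "x \<noteq> l k + 1" using False assms(1,2) even_l[of k] by auto
      ultimately have "l k + 2 \<le> x" using assms(3) by linarith
      with False show ?thesis using assms
        by (intro exI[of _ "x - 1"]) (auto simp: hexagon_iff)
    qed
  qed
  with * show "(x, k) \<in> vertices_of S" "(x, k + 1) \<in> vertices_of S" by blast+
qed

lemma adjacent_rows:
  assumes "1 \<le> k" "k \<le> int m + 1"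
  shows "\<bar>l k - l (k - 1)\<bar> = 1" "\<bar>r k - r (k - 1)\<bar> = 1"
  using l_step[of "k - 1"] r_step[of "k - 1"] assms by auto

text \<open>
  The zigzag has no gaps: adjacent rows overlap, because their ends differ by half a hexagon only
  and every row has at least one hexagon.
\<close>

lemma zigzag_vertex:
  assumes k: "1 \<le> k" "k \<le> int m + 1" and x: "left_end k \<le> x" "x \<le> right_end k"
  shows "(x, k) \<in> vertices_of S"
proof -
  have "k = 1 \<or> k = int m + 1 \<or> 2 \<le> k \<and> k \<le> int m" using k by linarith
  then have "(k \<le> int m \<and> l k \<le> x \<and> x \<le> r k) \<or> (2 \<le> k \<and> l (k - 1) \<le> x \<and> x \<le> r (k - 1))"
  proof (elim disjE)
    assume "k = 1"
    moreover note m_pos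
    ultimately show ?thesis using row_0 x by (auto simp: left_end_def right_end_def)
  next
    assume "k = int m + 1"
    moreover note m_pos
    ultimately show ?thesis using row_last x by (auto simp: left_end_def right_end_def)
  next
    assume k': "2 \<le> k \<and> k \<le> int m"
    have "l (k - 1) < r (k - 1)" "l k < r k" using k' l_less_r by auto
    moreover have "r k \<noteq> l k + 1"
      using even_l[of k] even_r[of k] k' by auto
    ultimately show ?thesis using x k' adjacent_rows[OF k]
      unfolding left_end_def right_end_def by linarith
  qed
  then show ?thesis
    using row_vertex(1)[of k x] row_vertex(2)[of "k - 1" x] k by auto
qed

text \<open>
  Two of the four edges are vertical, but only one of them exists in the lattice.  Listing both
  keeps the statement free of parities.
\<close>

lemma vertex_matched:
  assumes k: "1 \<le> k" "k \<le> int m + 1" and x: "left_end k \<le> x" "x \<le> right_end k"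
  shows "of_bool (slanted (x - 1) k \<in> K) + of_bool (slanted x k \<in> K)
    + of_bool (x \<in> bonds (k - 1)) + of_bool (x \<in> bonds k) = (1 :: int)"
proof -
  have "\<exists>!e. e \<in> K \<and> (x, k) \<in> e"
    using kekule zigzag_vertex[OF assms] by (auto simp: kekule_structure_def)
  then obtain e where e: "e \<in> K" "(x, k) \<in> e" and uniq: "\<And>f. f \<in> K \<Longrightarrow> (x, k) \<in> f \<Longrightarrow> f = e"
    by blast
  from e K_subset have "e \<in> edges_of S" by auto
  then have cases: "e = slanted (x - 1) k \<or> e = slanted x k \<or> e = vertical x (k - 1) \<or> e = vertical x k"
    using e(2) by (cases rule: edges_of_cases) (auto simp: mem_vertical_iff mem_slanted_iff edge_eq_simps)
  have in_K: "f \<in> K \<longleftrightarrow> f = e" if "(x, k) \<in> f" for f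
    using uniq[OF _ that] e by blast
  then have K_iff: "slanted (x - 1) k \<in> K \<longleftrightarrow> slanted (x - 1) k = e" "slanted x k \<in> K \<longleftrightarrow> slanted x k = e"
    "vertical x (k - 1) \<in> K \<longleftrightarrow> vertical x (k - 1) = e" "vertical x k \<in> K \<longleftrightarrow> vertical x k = e"
    by (simp_all add: in_K mem_slanted_iff mem_vertical_iff)
  from cases show ?thesis
    by (elim disjE) (simp_all add: K_iff bonds_def edge_eq_simps)
qed

lemma row_vertex_matched:
  assumes "1 \<le> k" "k \<le> int m" "l k \<le> x" "x \<le> r k"
  shows "of_bool (slanted (x - 1) k \<in> K) + of_bool (slanted x k \<in> K)
      + of_bool (x \<in> bonds (k - 1)) + of_bool (x \<in> bonds k) = (1 :: int)"
    and "of_bool (slanted (x - 1) (k + 1) \<in> K) + of_bool (slanted x (k + 1) \<in> K)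
      + of_bool (x \<in> bonds k) + of_bool (x \<in> bonds (k + 1)) = (1 :: int)"
  using vertex_matched[of k x] vertex_matched[of "k + 1" x] assms
  by (simp_all add: left_end_def right_end_def)

section \<open>Alternation of the double bonds along a zigzag\<close>

lemma finite_bonds: "finite (bonds k)"
  by (rule finite_subset[of _ "{l k..r k}"]) (auto dest: bondsD)

lemma count_step: "count k x = count k (x - 1) + of_bool (x \<in> bonds k)"
proof -
  have "{y \<in> bonds k. y \<le> x} = {y \<in> bonds k. y \<le> x - 1} \<union> (if x \<in> bonds k then {x} else {})"
    by (auto simp: order_le_less)
  then show ?thesis
    using finite_bonds[of k] by (simp add: count_def)
qed

lemma count_left: "x < l k \<Longrightarrow> count k x = 0"
proof -
  assume "x < l k"
  then have "{y \<in> bonds k. y \<le> x} = {}" using bondsD(3)[of _ k] by force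
  then show ?thesis unfolding count_def by (simp only: card.empty of_nat_0)
qed

lemma count_right: "r k \<le> x \<Longrightarrow> count k x = int (card (bonds k))"
proof -
  assume "r k \<le> x"
  then have "{y \<in> bonds k. y \<le> x} = bonds k" using bondsD(4)[of _ k] by force
  then show ?thesis by (simp add: count_def)
qed

lemma count_mono: "x \<le> y \<Longrightarrow> count k x \<le> count k y"
  using finite_bonds[of k] by (auto simp: count_def intro: card_mono)

text \<open>
  Give each vertex of zigzag \<open>k\<close> the sign \<open>+\<close> or \<open>-\<close> according as its vertical lattice edge
  leads up or down, and sum the signs of the vertices up to \<open>x\<close>.  The signs alternate, so the sum depends only
  on the signs of the first vertex and of \<open>x\<close>.  On the other hand the two vertices of a slanted
  double bond cancel, except when that bond joins \<open>x\<close> to \<open>x + 1\<close> and is cut; what remains is the number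
  of vertical double bonds leading up minus the number leading down.  As a result this difference takes
  only two consecutive values, which is the alternation of the double bonds.  The first
  \<open>of_bool\<close> tells whether the first bond of the fragment lies in the lower row.
\<close>

lemma fragment_balance:
  assumes k: "1 \<le> k" "k \<le> int m + 1" and x: "left_end k - 1 \<le> x" "x \<le> right_end k"
  shows "count (k - 1) x + of_bool (l k < l (k - 1))
    = count k x + of_bool (odd (x + k) \<noteq> (slanted x k \<in> K))"
  using x(1,2)
proof (induction x rule: int_ge_induct)
  case base
  have "slanted (left_end k - 1) k \<notin> K" using slanted_in_K_D(3) by fastforce
  moreover have "odd (left_end k - 1 + k) \<longleftrightarrow> l k < l (k - 1)"
    using adjacent_rows[OF k] even_l[of k] even_l[of "k - 1"] k
    by (auto simp: left_end_def min_def)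
  ultimately show ?case
    using count_left[of "left_end k - 1"] by (auto simp: left_end_def)
next
  case (step x)
  have IH: "count (k - 1) x + of_bool (l k < l (k - 1))
      = count k x + of_bool (odd (x + k) \<noteq> (slanted x k \<in> K))"
    using step by simp
  have matched: "of_bool (slanted x k \<in> K) + of_bool (slanted (x + 1) k \<in> K)
      + of_bool (x + 1 \<in> bonds (k - 1)) + of_bool (x + 1 \<in> bonds k) = (1 :: int)"
    using vertex_matched[OF k, of "x + 1"] step by simp
  have count: "count k (x + 1) = count k x + of_bool (x + 1 \<in> bonds k)"
    "count (k - 1) (x + 1) = count (k - 1) x + of_bool (x + 1 \<in> bonds (k - 1))"
    using count_step[of k "x + 1"] count_step[of "k - 1" "x + 1"] by simp_all
  show ?case
  proof (cases "even (x + k)")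
    case True
    then have "x + 1 \<notin> bonds k" "odd (x + 1 + k)" using bondsD(5)[of "x + 1" k] by auto
    with True IH matched count show ?thesis by (simp add: of_bool_not_iff)
  next
    case False
    then have "x + 1 \<notin> bonds (k - 1)" "even (x + 1 + k)" using bondsD(5)[of "x + 1" "k - 1"] by auto
    with False IH matched count show ?thesis by (simp add: of_bool_not_iff)
  qed
qed

text \<open>
  At the right end of a zigzag, the balance says that the numbers of double bonds in two adjacent
  rows differ as much as their lengths.  The right-hand side is twice \<open>ord\<close> of the interface.
\<close>

lemma card_bonds:
  assumes "0 \<le> k" "k \<le> int m + 1"
  shows "2 * int (card (bonds k)) = r k - l k + 2 - 2 * int n"
  using assms
proof (induction k rule: int_ge_induct)
  case base
  have "bonds 0 = {}" using bondsD(1)[of _ 0] by force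
  then show ?case using row_0 by simp
next
  case (step k)
  let ?x = "right_end (k + 1)"
  have k: "1 \<le> k + 1" "k + 1 \<le> int m + 1" using step by auto
  have IH: "2 * int (card (bonds k)) = r k - l k + 2 - 2 * int n" using step by simp
  have "left_end (k + 1) - 1 \<le> ?x"
  proof (cases "k = 0")
    case True
    then show ?thesis using row_0 l_less_r[of 1] m_pos by (simp add: left_end_def right_end_def)
  next
    case False
    then show ?thesis using l_less_r[of k] step k by (simp add: left_end_def right_end_def)
  qed
  then have "count k ?x + of_bool (l (k + 1) < l k)
      = count (k + 1) ?x + of_bool (odd (?x + (k + 1)) \<noteq> (slanted ?x (k + 1) \<in> K))"
    using fragment_balance[OF k, of ?x] by simp
  moreover have "slanted ?x (k + 1) \<notin> K" using slanted_in_K_D(4)[of ?x "k + 1"] by auto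
  moreover have "count k ?x = int (card (bonds k))" "count (k + 1) ?x = int (card (bonds (k + 1)))"
    by (rule count_right; simp add: right_end_def)+
  moreover have "odd (?x + (k + 1)) \<longleftrightarrow> r (k + 1) < r k"
    using adjacent_rows(2)[OF k] even_r[of k] even_r[of "k + 1"] k
    by (auto simp: right_end_def max_def)
  ultimately have "int (card (bonds k)) + of_bool (l (k + 1) < l k)
      = int (card (bonds (k + 1))) + of_bool (r (k + 1) < r k)"
    by simp
  moreover have "l (k + 1) = l k + 1 - 2 * of_bool (l (k + 1) < l k)"
    "r (k + 1) = r k + 1 - 2 * of_bool (r (k + 1) < r k)"
    using adjacent_rows[OF k] by (auto simp: of_bool_def)
  ultimately show ?case using IH by linarith
qed

text \<open>
  At a vertex matched by an interface bond no slanted bond is cut, so the balance determines how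
  many double bonds of the adjacent row lie further to the left.  The correction is the index
  difference \<open>j' - j\<close> that defines the covers of the poset.
\<close>

lemma count_neighbour_row:
  assumes x: "x \<in> bonds k'" and k: "\<bar>k - k'\<bar> = 1"
  shows "count k x + of_bool (l k' < l k) = count k' x"
proof -
  note x' = bondsD[OF x]
  from k consider "k = k' - 1" | "k = k' + 1" by linarith
  then show ?thesis
  proof cases
    case 1
    have range: "1 \<le> k'" "k' \<le> int m + 1" "left_end k' \<le> x" "x \<le> right_end k'"
      using x' by (auto simp: left_end_def right_end_def)
    have "slanted x k' \<notin> K"
      using vertex_matched[OF range] x by (auto simp: of_bool_def split: if_splits)
    with fragment_balance[of k' x] range x' 1 show ?thesis by simp
  next
    case 2
    have range: "1 \<le> k" "k \<le> int m + 1" "left_end k \<le> x" "x \<le> right_end k"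
      using x' 2 by (auto simp: left_end_def right_end_def)
    have "slanted x k \<notin> K"
      using vertex_matched[OF range] x 2 by (auto simp: of_bool_def split: if_splits)
    moreover have "of_bool (l k < l k') = 1 - (of_bool (l k' < l k) :: int)"
      using adjacent_rows(1)[OF range(1,2)] 2 by (auto simp: of_bool_def)
    ultimately show ?thesis using fragment_balance[of k x] range x' 2 by simp
  qed
qed

lemma count_less:
  assumes "x \<in> bonds k" "y < x"
  shows "count k y < count k x"
  using count_mono[of y "x - 1" k] count_step[of k x] assms by simp

section \<open>The coordinates of the double interface bonds\<close>

definition place :: "int \<times> nat \<Rightarrow> int" where
  "place s = (THE x. x \<in> bonds (fst s) \<and> count (fst s) x = int (snd s))"

lemma place_eqI:
  assumes "x \<in> bonds k" "count k x = int j"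
  shows "place (k, j) = x"
  unfolding place_def
proof (rule the_equality)
  fix y assume "y \<in> bonds (fst (k, j)) \<and> count (fst (k, j)) y = int (snd (k, j))"
  with assms count_less[of y k x] count_less[of x k y] show "y = x"
    by (cases x y rule: linorder_cases) auto
qed (use assms in simp)

lemma card_row:
  assumes "1 \<le> k" "k \<le> int m" "l k \<le> x" "even (x + k)"
  shows "2 * int (card {y. l k \<le> y \<and> y \<le> x \<and> even (y + k)}) = x - l k + 2"
proof -
  have "even (x - l k)" using assms even_l[of k] by simp
  then obtain q where q: "x - l k = 2 * q" by (elim evenE)
  have "{y. l k \<le> y \<and> y \<le> x \<and> even (y + k)} = (\<lambda>i. l k + 2 * i) ` {0..q}"
  proof (intro set_eqI iffI)
    fix y assume y: "y \<in> {y. l k \<le> y \<and> y \<le> x \<and> even (y + k)}"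
    then have "even (y - l k)" using assms even_l[of k] by simp
    then obtain i where "y - l k = 2 * i" by (elim evenE)
    with y q show "y \<in> (\<lambda>i. l k + 2 * i) ` {0..q}" by (intro image_eqI[of _ _ i]) auto
  next
    fix y assume "y \<in> (\<lambda>i. l k + 2 * i) ` {0..q}"
    then show "y \<in> {y. l k \<le> y \<and> y \<le> x \<and> even (y + k)}" using assms q even_l[of k] by auto
  qed
  moreover have "inj (\<lambda>i. l k + 2 * i)" by (simp add: inj_def)
  ultimately have "card {y. l k \<le> y \<and> y \<le> x \<and> even (y + k)} = card {0..q}"
    using card_image[of "\<lambda>i. l k + 2 * i" "{0..q}"] by (simp add: inj_on_def)
  moreover have "0 \<le> q" using q assms by linarith
  ultimately show ?thesis using q by simp
qed

lemma inj_vertical: "inj_on (\<lambda>x. vertical x k) X"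
  by (simp add: inj_on_def edge_eq_simps)

lemma inj_hpos_row: "inj_on hpos ((\<lambda>x. vertical x k) ` X)"
  by (auto simp: inj_on_def hpos_vertical)

lemma rank_in_row:
  "card {e \<in> (\<lambda>x. vertical x k) ` X. hpos e \<le> hpos (vertical x k)} = card {y \<in> X. y \<le> x}"
proof -
  have "{e \<in> (\<lambda>x. vertical x k) ` X. hpos e \<le> hpos (vertical x k)}
      = (\<lambda>x. vertical x k) ` {y \<in> X. y \<le> x}"
    by (auto simp: hpos_vertical)
  then show ?thesis by (simp add: card_image inj_vertical)
qed

lemma finite_row: "finite {x. l k \<le> x \<and> x \<le> r k \<and> even (x + k)}"
  by (rule finite_subset[of _ "{l k..r k}"]) auto

lemma card_interface:
  assumes "1 \<le> k" "k \<le> int m"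
  shows "2 * int (card (interface S k)) = r k - l k + 2"
  using card_row[OF assms, of "r k"] l_less_r[OF assms] even_r[of k] assms
  by (simp add: interface_eq card_image inj_vertical conj_assoc)

lemma strip_poset_iff:
  "(k, j) \<in> strip_poset m n S \<longleftrightarrow> 1 \<le> k \<and> k \<le> int m \<and> 1 \<le> j \<and> j \<le> card (bonds k)"
proof -
  have "ord_interface n S k = int (card (bonds k))" if "1 \<le> k" "k \<le> int m"
    using card_interface[OF that] card_bonds[of k] that by (simp add: ord_interface_def)
  then show ?thesis by (auto simp: strip_poset_def)
qed

lemma place:
  assumes "(k, j) \<in> strip_poset m n S"
  shows "place (k, j) \<in> bonds k" "count k (place (k, j)) = int j"
proof -
  have "j \<in> (\<lambda>x. card {y \<in> bonds k. y \<le> x}) ` bonds k"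
    using rank_bij_betw[OF finite_bonds[of k], of id] assms
    by (simp add: strip_poset_iff bij_betw_def)
  then obtain x where "x \<in> bonds k" "count k x = int j" by (auto simp: count_def)
  with place_eqI[of x k j] show "place (k, j) \<in> bonds k" "count k (place (k, j)) = int j"
    by simp_all
qed

lemma tau_eq:
  assumes "(k, j) \<in> strip_poset m n S"
  shows "tau m S K (k, j) = vertical (place (k, j)) k"
proof -
  have k: "1 \<le> k" "k \<le> int m" using assms by (simp_all add: strip_poset_iff)
  have "double_interface_bonds m S K \<inter> interface S k = K \<inter> interface S k"
    using k by (auto simp: double_interface_bonds_def)
  also have "\<dots> = (\<lambda>x. vertical x k) ` bonds k" (is "_ = ?E")
    using bondsD[of _ k] by (auto simp: interface_eq[OF k] bonds_def)
  finally have "tau m S K (k, j) = nth_from_left ?E j" by simp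
  moreover have "card {e \<in> ?E. hpos e \<le> hpos (vertical (place (k, j)) k)} = j"
    using place(2)[OF assms] by (simp add: rank_in_row count_def)
  ultimately show ?thesis
    using nth_from_left_rank[of ?E "vertical (place (k, j)) k"] place(1)[OF assms]
    by (simp add: finite_bonds inj_hpos_row)
qed

lemma pos_eq:
  assumes "(k, j) \<in> strip_poset m n S"
  shows "2 * int (pos m S K (k, j)) = place (k, j) - l k + 2"
proof -
  let ?X = "{x. l k \<le> x \<and> x \<le> r k \<and> even (x + k)}" and ?x = "place (k, j)"
  let ?q = "card {y \<in> ?X. y \<le> ?x}"
  note x = bondsD[OF place(1)[OF assms]]
  have row: "interface S k = (\<lambda>x. vertical x k) ` ?X" by (rule interface_eq[OF x(1,2)])
  have fin: "finite (interface S k)" and inj: "inj_on hpos (interface S k)"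
    by (simp_all only: row finite_imageI finite_row inj_hpos_row)
  have mem: "vertical ?x k \<in> interface S k" using x by (simp add: row)
  have rank: "card {e \<in> interface S k. hpos e \<le> hpos (vertical ?x k)} = ?q"
    unfolding row by (rule rank_in_row)
  have "pos m S K (k, j) = ?q"
    unfolding pos.simps tau_eq[OF assms] interface_edge_def
  proof (rule the_equality)
    show "?q \<in> {1..card (interface S k)} \<and> vertical ?x k = nth_from_left (interface S k) ?q"
      using nth_from_left_rank[OF fin inj mem] bij_betw_apply[OF rank_bij_betw[OF fin inj] mem]
      unfolding rank by simp
    fix q assume "q \<in> {1..card (interface S k)} \<and> vertical ?x k = nth_from_left (interface S k) q"
    then show "q = ?q" using nth_from_left_in(2)[OF fin inj, of q] rank by simp
  qed
  moreover have "{y \<in> ?X. y \<le> ?x} = {y. l k \<le> y \<and> y \<le> ?x \<and> even (y + k)}"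
    using x(4) by auto
  ultimately show ?thesis using card_row[OF x(1,2,3,5)] by simp
qed

section \<open>The cover relation\<close>

lemma first_bond:
  assumes k: "1 \<le> k" "k \<le> int m" "1 \<le> k'" "k' \<le> int m" "\<bar>k' - k\<bar> = 1" and less: "l k < l k'"
  shows "nth_from_left (interface_bonds S (max k k')) 1 = vertical (l k) k"
proof -
  let ?E = "interface_bonds S (max k k')"
  from k(5) have "k = max k k' \<and> k' = max k k' - 1 \<or> k' = max k k' \<and> k = max k k' - 1" by linarith
  then have E: "?E = interface S k \<union> interface S k'"
    unfolding interface_bonds_def by (metis Un_commute)
  have fin: "finite ?E"
    using finite_row[of k] finite_row[of k']
    unfolding E interface_eq[OF k(1,2)] interface_eq[OF k(3,4)] by blast
  have parity: "x \<noteq> y" if "even (x + k)" "even (y + k')" for x y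
    using that k(5) by presburger
  have vert: "\<exists>x. (e = vertical x k \<and> even (x + k)) \<or> (e = vertical x k' \<and> even (x + k'))"
    if "e \<in> ?E" for e
    using that unfolding E interface_eq[OF k(1,2)] interface_eq[OF k(3,4)] by blast
  have inj: "inj_on hpos ?E"
  proof (rule inj_onI)
    fix e f assume "e \<in> ?E" "f \<in> ?E" and eq: "hpos e = hpos f"
    then obtain x y where
      e: "(e = vertical x k \<and> even (x + k)) \<or> (e = vertical x k' \<and> even (x + k'))" and
      f: "(f = vertical y k \<and> even (y + k)) \<or> (f = vertical y k' \<and> even (y + k'))"
      using vert by meson
    with eq have "x = y" by (auto simp: hpos_vertical)
    with e f parity[of x x] show "e = f" by blast
  qed
  have mem: "vertical (l k) k \<in> ?E"
    using k even_l[of k] l_less_r[of k] by (simp add: E interface_eq)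
  have "{e \<in> ?E. hpos e \<le> hpos (vertical (l k) k)} = {vertical (l k) k}"
  proof (intro equalityI subsetI)
    fix e assume e: "e \<in> {e \<in> ?E. hpos e \<le> hpos (vertical (l k) k)}"
    then have "e \<in> (\<lambda>x. vertical x k) ` {x. l k \<le> x}
        \<or> e \<in> (\<lambda>x. vertical x k') ` {x. l k' \<le> x}"
      unfolding E interface_eq[OF k(1,2)] interface_eq[OF k(3,4)] by blast
    then show "e \<in> {vertical (l k) k}" using e less by (auto simp: hpos_vertical)
  qed (use mem in simp)
  with nth_from_left_rank[OF fin inj mem] show ?thesis by simp
qed

lemma strip_cover_iff:
  "((k, j), (k', j')) \<in> strip_cover m n S \<longleftrightarrow>
    (k, j) \<in> strip_poset m n S \<and> (k', j') \<in> strip_poset m n S \<and> \<bar>k' - k\<bar> = 1 \<and>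
    int j' = int j + of_bool (l k' < l k)"
proof (cases "(k, j) \<in> strip_poset m n S \<and> (k', j') \<in> strip_poset m n S \<and> \<bar>k' - k\<bar> = 1")
  case True
  then have k: "1 \<le> k" "k \<le> int m" "1 \<le> k'" "k' \<le> int m" "\<bar>k' - k\<bar> = 1" "\<bar>k - k'\<bar> = 1"
    by (auto simp: strip_poset_iff)
  let ?b = "nth_from_left (interface_bonds S (max k k')) 1"
  have end_mem: "vertical (l i) i \<in> interface S i \<and> vertical (l i) i \<notin> interface S i'"
    if "1 \<le> i" "i \<le> int m" "1 \<le> i'" "i' \<le> int m" "i \<noteq> i'" for i i'
    using that even_l[of i] l_less_r[of i] by (auto simp: interface_eq edge_eq_simps)
  have "l k \<noteq> l k'"
  proof -
    from k have "k' = k + 1 \<or> k = k' + 1" by linarith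
    then show ?thesis using l_step[of k] l_step[of k'] k by auto
  qed
  then consider "l k < l k'" | "l k' < l k" by linarith
  then show ?thesis
  proof cases
    case 1
    with first_bond[OF k(1-5)] have "?b = vertical (l k) k" by simp
    with end_mem[of k k'] k have "?b \<in> interface S k" "?b \<notin> interface S k'" by auto
    with True 1 show ?thesis by (simp add: strip_cover_def)
  next
    case 2
    with first_bond[OF k(3,4,1,2,6)] have "?b = vertical (l k') k'" by (simp add: max.commute)
    with end_mem[of k' k] k have "?b \<notin> interface S k" "?b \<in> interface S k'" by auto
    with True 2 show ?thesis by (auto simp: strip_cover_def)
  qed
qed (auto simp: strip_cover_def)

section \<open>The shift\<close>

text \<open>
  Double bonds of one row are at least a hexagon apart.  Applied to the left and to the right of a
  bond, this bounds its index in terms of its place and yields the range of \<open>shift\<close>.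
\<close>

lemma count_growth:
  assumes "even (x + k)"
  shows "count k (x + 2 * int i) \<le> count k x + int i"
proof (induction i)
  case (Suc i)
  let ?y = "x + 2 * int i"
  have "?y + 1 \<notin> bonds k" using bondsD(5)[of "?y + 1" k] assms by auto
  then have "count k (?y + 2) \<le> count k ?y + 1"
    using count_step[of k "?y + 1"] count_step[of k "?y + 1 + 1"]
    by (simp add: of_bool_def algebra_simps split: if_splits)
  with Suc show ?case by (simp add: algebra_simps)
qed simp

lemma count_growth_between:
  assumes "even (x + k)" "even (y + k)" "x \<le> y"
  shows "2 * (count k y - count k x) \<le> y - x"
proof -
  have "even (y - x)" using assms by simp
  then obtain i where i: "y - x = 2 * i" by (elim evenE)
  then have "y = x + 2 * int (nat i)" using assms by simp
  with count_growth[OF assms(1), of "nat i"] i assms show ?thesis by simp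
qed

text \<open>
  The extension to the whole poset of the only candidate for \<open>\<mu>\<close>.  It is integer-valued, so that
  differences do not truncate.
\<close>

definition shift :: "int \<times> nat \<Rightarrow> int" where
  "shift s = int (pos m S K s) - int (snd s)"

lemma shift_eq:
  assumes "(k, j) \<in> strip_poset m n S"
  shows "2 * shift (k, j) = place (k, j) - l k + 2 - 2 * int j"
  using pos_eq[OF assms] by (simp add: shift_def)

lemma shift_le_n:
  assumes "(k, j) \<in> strip_poset m n S"
  shows "shift (k, j) \<le> int n"
proof -
  note x = bondsD[OF place(1)[OF assms]]
  have "2 * (count k (r k) - int j) \<le> r k - place (k, j)"
    using count_growth_between[of "place (k, j)" k "r k"] x even_r[of k] place(2)[OF assms] by simp
  with shift_eq[OF assms] card_bonds[of k] count_right[of k "r k"] x show ?thesis by simp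
qed

lemma shift_nonneg:
  assumes "(k, j) \<in> strip_poset m n S"
  shows "0 \<le> shift (k, j)"
proof -
  note x = bondsD[OF place(1)[OF assms]]
  have "2 * (int j - count k (l k - 2)) \<le> place (k, j) - (l k - 2)"
    using count_growth_between[of "l k - 2" k "place (k, j)"] x even_l[of k] place(2)[OF assms] by simp
  with shift_eq[OF assms] count_left[of "l k - 2" k] show ?thesis by simp
qed

text \<open>
  The interface edge at \<open>place - 2\<close>, if it is single, is one of those that \<open>shift\<close> counts.
\<close>

lemma shift_pos:
  assumes "(k, j) \<in> strip_poset m n S"
    and "l k < place (k, j)" "place (k, j) - 2 \<notin> bonds k"
  shows "1 \<le> shift (k, j)"
proof -
  let ?x = "place (k, j)"
  note x = bondsD[OF place(1)[OF assms(1)]]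
  have "?x \<noteq> l k + 1" using x even_l[of k] by auto
  with assms(2) have ge: "l k \<le> ?x - 2" by linarith
  have "?x - 1 \<notin> bonds k" using bondsD(5)[of "?x - 1" k] x by auto
  then have "count k (?x - 4) = int j - 1"
    using count_step[of k ?x] count_step[of k "?x - 1"] count_step[of k "?x - 2"]
      count_step[of k "?x - 3"] bondsD(5)[of "?x - 3" k] x assms(3) place[OF assms(1)] by auto
  moreover have "2 * (count k (?x - 4) - count k (l k - 2)) \<le> ?x - 4 - (l k - 2)"
    using count_growth_between[of "l k - 2" k "?x - 4"] ge x even_l[of k] by simp
  ultimately show ?thesis
    using shift_eq[OF assms(1)] count_left[of "l k - 2" k] by simp
qed

text \<open>
  By \<open>count_neighbour_row\<close> exactly \<open>j\<close> double bonds of the row of \<open>s\<close> precede the bond of \<open>t\<close>, and the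
  bond of \<open>s\<close> is the last of them.  In the formula for \<open>shift\<close>, the difference of the indices and
  that of the row ends always combine to one half-hexagon.
\<close>

lemma cover_step:
  assumes "(s, t) \<in> strip_cover m n S"
  shows "place s < place t" "2 * (shift t - shift s) = place t - place s - 1"
proof -
  obtain k j k' j' where st: "s = (k, j)" "t = (k', j')" by (metis surj_pair)
  with assms have s: "(k, j) \<in> strip_poset m n S" and t: "(k', j') \<in> strip_poset m n S"
    and adj: "\<bar>k' - k\<bar> = 1" and j': "int j' = int j + of_bool (l k' < l k)"
    by (simp_all add: strip_cover_iff)
  have "count k (place t) = count k (place s)"
    using count_neighbour_row[OF place(1)[OF t], of k] adj j' place(2)[OF t] place(2)[OF s] st
    by simp
  then have "place s \<le> place t"
    using count_less[OF place(1)[OF s], of "place t"] st by (cases "place t < place s") auto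
  moreover have "even k \<noteq> even k'" using adj by presburger
  then have "place s \<noteq> place t"
    using bondsD(5)[OF place(1)[OF s]] bondsD(5)[OF place(1)[OF t]] st by auto
  ultimately show "place s < place t" by simp
  have "k' = k + 1 \<or> k = k' + 1" using adj by linarith
  then have "\<bar>l k' - l k\<bar> = 1"
    using l_step[of k] l_step[of k'] bondsD(1,2)[OF place(1)[OF s]] bondsD(1,2)[OF place(1)[OF t]]
    by auto
  then have "l k' - l k + 2 * of_bool (l k' < l k) = 1" by (auto simp: of_bool_def)
  with shift_eq[OF s] shift_eq[OF t] j' st
  show "2 * (shift t - shift s) = place t - place s - 1" by simp
qed

text \<open>
  Two double bonds half a hexagon apart are consecutive in their fragment, hence form a cover.
\<close>

lemma cover_predecessor:
  assumes t: "(k', j') \<in> strip_poset m n S" and adj: "\<bar>k' - k\<bar> = 1"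
    and mem: "place (k', j') - 1 \<in> bonds k"
  obtains j where "((k, j), (k', j')) \<in> strip_cover m n S" "place (k, j) = place (k', j') - 1"
proof -
  let ?x = "place (k', j')"
  define j where "j = nat (count k (?x - 1))"
  have j: "count k (?x - 1) = int j" by (simp add: j_def count_def)
  note x = bondsD[OF place(1)[OF t]] and x' = bondsD[OF mem]
  have "count k (?x - 2) \<ge> 0" by (simp add: count_def)
  then have "1 \<le> j" using count_step[of k "?x - 1"] j mem by simp
  moreover have "j \<le> card (bonds k)"
    using count_mono[of "?x - 1" "r k" k] count_right[of k "r k"] x' j by simp
  ultimately have s: "(k, j) \<in> strip_poset m n S" using x' by (simp add: strip_poset_iff)
  have "odd (?x + k)" using x' by auto
  then have "count k ?x = int j" using count_step[of k ?x] bondsD(5)[of ?x k] j by auto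
  then have "int j' = int j + of_bool (l k' < l k)"
    using count_neighbour_row[OF place(1)[OF t], of k] adj place(2)[OF t] by simp
  with s t adj have "((k, j), (k', j')) \<in> strip_cover m n S" by (simp add: strip_cover_iff)
  then show thesis using that place_eqI[OF mem j] by blast
qed

section \<open>Proper sextets\<close>

text \<open>
  For the vertex at \<open>x - 1\<close>, the slanted edge towards \<open>x\<close> is excluded, because \<open>x\<close> is covered by
  its interface bond.  So that vertex is matched either to the left, or by its own interface bond.
\<close>

lemma slanted_iff_no_neighbour:
  assumes x: "x \<in> bonds k" "l k < x"
  shows "slanted (x - 2) k \<in> K \<longleftrightarrow> x - 1 \<notin> bonds (k - 1)"
    and "slanted (x - 2) (k + 1) \<in> K \<longleftrightarrow> x - 1 \<notin> bonds (k + 1)"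
proof -
  note x' = bondsD[OF x(1)]
  have range: "l k \<le> x - 1" "x - 1 \<le> r k" using x x' by auto
  have "x - 1 \<notin> bonds k" using bondsD(5)[of "x - 1" k] x' by auto
  then show "slanted (x - 2) k \<in> K \<longleftrightarrow> x - 1 \<notin> bonds (k - 1)"
    and "slanted (x - 2) (k + 1) \<in> K \<longleftrightarrow> x - 1 \<notin> bonds (k + 1)"
    using row_vertex_matched[OF x'(1-4)] row_vertex_matched[OF x'(1,2) range] x
    by (auto simp: of_bool_def split: if_splits)
qed

text \<open>
  A vertical edge participates in a proper sextet only as the right edge of its hexagon, so the
  hexagon is determined.  It belongs to the strip unless the bond is at the left end of its row.
\<close>

lemma sextet_poset_iff:
  assumes s: "(k, j) \<in> strip_poset m n S"
  shows "(k, j) \<in> sextet_poset m n S K \<longleftrightarrow>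
    l k < place (k, j) \<and> place (k, j) - 1 \<notin> bonds (k - 1) \<and> place (k, j) - 1 \<notin> bonds (k + 1)"
proof -
  let ?x = "place (k, j)"
  note x = bondsD[OF place(1)[OF s]]
  have "(k, j) \<in> sextet_poset m n S K \<longleftrightarrow> proper_sextet S K (?x - 1, k)"
    using s by (auto simp: sextet_poset_def participates_in_proper_sextet_def tau_eq[OF s] edge_eq_simps
      simp del: tau.simps)
  also have "\<dots> \<longleftrightarrow> l k < ?x - 1 \<and> slanted (?x - 2) k \<in> K \<and> slanted (?x - 2) (k + 1) \<in> K"
    using x place(1)[OF s] by (auto simp: proper_sextet_def hexagon_iff bonds_def)
  also have "l k < ?x - 1 \<longleftrightarrow> l k < ?x"
  proof -
    have "?x \<noteq> l k + 1" using x even_l[of k] by auto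
    then show ?thesis by linarith
  qed
  finally show ?thesis using slanted_iff_no_neighbour[OF place(1)[OF s]] by blast
qed

text \<open>
  The left edge of a proper sextet is single, since its vertices are matched by the slanted edges.
\<close>

lemma sextet_shift_pos:
  assumes "s \<in> sextet_poset m n S K"
  shows "1 \<le> shift s"
proof -
  obtain k j where s: "s = (k, j)" by (cases s)
  with assms have p: "(k, j) \<in> strip_poset m n S" by (simp add: sextet_poset_def)
  let ?x = "place (k, j)"
  note x = bondsD[OF place(1)[OF p]]
  have lx: "l k < ?x" and "slanted (?x - 2) k \<in> K"
    using sextet_poset_iff[OF p] slanted_iff_no_neighbour(1)[OF place(1)[OF p]] assms s by auto
  moreover have "?x \<noteq> l k + 1" using x even_l[of k] by auto
  ultimately have "?x - 2 \<notin> bonds k"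
    using row_vertex_matched(1)[of k "?x - 2"] x by (auto simp: of_bool_def split: if_splits)
  with shift_pos[OF p lx] s show ?thesis by simp
qed

lemma cover_into_sextet:
  assumes "(s, t) \<in> strip_cover m n S" "t \<in> sextet_poset m n S K"
  shows "shift s < shift t"
proof -
  obtain k j k' j' where st: "s = (k, j)" "t = (k', j')" by (metis surj_pair)
  with assms have s: "(k, j) \<in> strip_poset m n S" and t: "(k', j') \<in> strip_poset m n S"
    and adj: "\<bar>k' - k\<bar> = 1"
    by (simp_all add: strip_cover_iff)
  from adj have "k = k' - 1 \<or> k = k' + 1" by linarith
  then have "place t - 1 \<notin> bonds k"
    using sextet_poset_iff[OF t] assms(2) st by auto
  then have "place s \<noteq> place t - 1" using place(1)[OF s] st by auto
  with cover_step(1)[OF assms(1)] have "1 < place t - place s" by simp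
  with cover_step(2)[OF assms(1)] show ?thesis by simp
qed

lemma less_shift:
  assumes "(s, t) \<in> strip_less m n S"
  shows "shift s \<le> shift t" "t \<in> sextet_poset m n S K \<Longrightarrow> shift s < shift t"
proof -
  have "shift s \<le> shift t \<and> (t \<in> sextet_poset m n S K \<longrightarrow> shift s < shift t)"
    using assms unfolding strip_less_def
  proof (induction rule: trancl_induct)
    case (base t)
    with cover_step[OF base] cover_into_sextet[OF base] show ?case by auto
  next
    case (step t u)
    with cover_step[OF step(2)] cover_into_sextet[OF step(2)] show ?case by auto
  qed
  then show "shift s \<le> shift t" "t \<in> sextet_poset m n S K \<Longrightarrow> shift s < shift t" by auto
qed

text \<open>
  The descent moves the place by \<open>1\<close> to the left at each step, and places are bounded below by the
  leftmost end \<open>B\<close> of a row, so it terminates.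
\<close>

lemma nonsextet_shift_attained:
  assumes "t \<in> strip_poset m n S - sextet_poset m n S K" "shift t \<noteq> 0"
  shows "\<exists>s \<in> sextet_poset m n S K. (s, t) \<in> strip_less m n S \<and> shift s = shift t"
proof -
  define B where "B = Min (l ` {1..int m})"
  have B: "B \<le> place s" if "s \<in> strip_poset m n S" for s
  proof -
    obtain k j where s: "s = (k, j)" by (cases s)
    with that have "place s \<in> bonds k" using place(1) by simp
    then have "k \<in> {1..int m}" "l k \<le> place s" using bondsD by auto
    then show ?thesis unfolding B_def by (meson Min_le finite_imageI finite_atLeastAtMost_int imageI order_trans)
  qed
  show ?thesis using assms
  proof (induction "nat (place t - B)" arbitrary: t rule: less_induct)
    case less
    obtain k j where t: "t = (k, j)" by (cases t)
    with less have p: "(k, j) \<in> strip_poset m n S" and not: "(k, j) \<notin> sextet_poset m n S K" by auto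
    note x = bondsD[OF place(1)[OF p]]
    (* The first bond of a row has index 1 and position 1, hence shift 0. *)
    have "l k \<noteq> place t"
    proof
      assume eq: "l k = place t"
      have "1 \<le> j" using p by (simp add: strip_poset_iff)
      with shift_eq[OF p] eq t shift_nonneg[OF p] less show False by simp
    qed
    with x t have "l k < place (k, j)" by simp
    with not sextet_poset_iff[OF p]
    have "place (k, j) - 1 \<in> bonds (k - 1) \<or> place (k, j) - 1 \<in> bonds (k + 1)" by blast
    then obtain k' where "\<bar>k - k'\<bar> = 1" "place (k, j) - 1 \<in> bonds k'" by force
    then obtain j' where cov: "((k', j'), t) \<in> strip_cover m n S"
      and pl: "place (k', j') = place t - 1"
      using cover_predecessor[OF p] t by metis
    have eq: "shift (k', j') = shift t" using cover_step(2)[OF cov] pl by simp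
    have p': "(k', j') \<in> strip_poset m n S" using cov t by (simp add: strip_cover_iff)
    show ?case
    proof (cases "(k', j') \<in> sextet_poset m n S K")
      case True
      with cov eq show ?thesis unfolding strip_less_def by blast
    next
      case False
      have "nat (place (k', j') - B) < nat (place t - B)" using B[OF p'] pl by simp
      then obtain s where "s \<in> sextet_poset m n S K" "(s, (k', j')) \<in> strip_less m n S"
        "shift s = shift (k', j')"
        using less(1)[of "(k', j')"] False p' eq less(3) by auto
      with cov eq show ?thesis unfolding strip_less_def by (metis trancl_into_trancl)
    qed
  qed
qed

section \<open>The order-preserving map\<close>

lemma finite_strip_poset: "finite (strip_poset m n S)"
proof (rule finite_subset)
  show "strip_poset m n S \<subseteq> (SIGMA k:{1..int m}. {1..card (bonds k)})"
    by (auto simp: strip_poset_iff)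
qed auto

theorem unique_order_preserving_map:
  "\<exists>!\<mu> :: int \<times> nat \<Rightarrow> nat.
    \<mu> \<in> sextet_poset m n S K \<rightarrow>\<^sub>E {1..n} \<and>
    monotone_on (sextet_poset m n S K) (\<lambda>s t. (s, t) \<in> strip_less m n S) (<) \<mu> \<and>
    (\<forall>(k, j) \<in> sextet_poset m n S K. pos m S K (k, j) = \<mu> (k, j) + j) \<and>
    (\<forall>(k, j) \<in> strip_poset m n S - sextet_poset m n S K.
       pos m S K (k, j) =
         Max ({\<mu> s | s. s \<in> sextet_poset m n S K \<and> (s, (k, j)) \<in> strip_less m n S} \<union> {0}) + j)"
proof (rule ex1I)
  let ?A = "sextet_poset m n S K"
  (* Outside the sextet poset the map is undefined, as extensional function spaces require. *)
  define \<mu> where "\<mu> = restrict (\<lambda>s. nat (shift s)) ?A"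
  have sub: "?A \<subseteq> strip_poset m n S" by (auto simp: sextet_poset_def)
  have shift_range: "0 \<le> shift s" "shift s \<le> int n" if "s \<in> strip_poset m n S" for s
    using that shift_nonneg shift_le_n by (cases s; simp)+
  have \<mu>_eq: "int (\<mu> s) = shift s" if "s \<in> ?A" for s
    using that shift_range(1)[of s] sub by (auto simp: \<mu>_def)
  have pos_shift: "int (pos m S K (k, j)) = shift (k, j) + int j" for k j
    by (simp add: shift_def)
  have "\<mu> \<in> ?A \<rightarrow>\<^sub>E {1..n}"
  proof (rule PiE_I)
    fix s assume s: "s \<in> ?A"
    with sub have "shift s \<le> int n" using shift_range(2) by blast
    with \<mu>_eq[OF s] sextet_shift_pos[OF s] show "\<mu> s \<in> {1..n}" by simp
  qed (simp add: \<mu>_def)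
  moreover have "monotone_on ?A (\<lambda>s t. (s, t) \<in> strip_less m n S) (<) \<mu>"
  proof (rule monotone_onI)
    fix s t assume "s \<in> ?A" "t \<in> ?A" "(s, t) \<in> strip_less m n S"
    with less_shift(2)[of s t] \<mu>_eq[of s] \<mu>_eq[of t] show "\<mu> s < \<mu> t" by simp
  qed
  moreover have "pos m S K (k, j) = \<mu> (k, j) + j" if "(k, j) \<in> ?A" for k j
    using \<mu>_eq[OF that] pos_shift[of k j] by simp
  moreover have "pos m S K (k, j)
      = Max ({\<mu> s | s. s \<in> ?A \<and> (s, (k, j)) \<in> strip_less m n S} \<union> {0}) + j"
    if t: "(k, j) \<in> strip_poset m n S - ?A" for k j
  proof -
    let ?M = "{\<mu> s | s. s \<in> ?A \<and> (s, (k, j)) \<in> strip_less m n S} \<union> {0}"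
    have nonneg: "0 \<le> shift (k, j)" using t shift_range(1) by blast
    have "Max ?M = nat (shift (k, j))"
    proof (rule Max_eqI)
      have "?M \<subseteq> \<mu> ` ?A \<union> {0}" by auto
      then show "finite ?M"
        using finite_subset[OF sub finite_strip_poset] by (meson finite.intros finite_UnI finite_imageI finite_subset)
    next
      fix y assume "y \<in> ?M"
      then consider "y = 0" | s where "y = \<mu> s" "s \<in> ?A" "(s, (k, j)) \<in> strip_less m n S" by blast
      then show "y \<le> nat (shift (k, j))"
      proof cases
        case 2
        with less_shift(1)[of s "(k, j)"] \<mu>_eq[of s] show ?thesis by simp
      qed simp
    next
      show "nat (shift (k, j)) \<in> ?M"
      proof (cases "shift (k, j) = 0")
        case False
        then obtain s where s: "s \<in> ?A" "(s, (k, j)) \<in> strip_less m n S" "shift s = shift (k, j)"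
          using nonsextet_shift_attained[OF t] by blast
        then have "nat (shift (k, j)) = \<mu> s" using \<mu>_eq[of s] by simp
        with s show ?thesis by blast
      qed simp
    qed
    with pos_shift[of k j] nonneg show ?thesis by simp
  qed
  ultimately show "\<mu> \<in> ?A \<rightarrow>\<^sub>E {1..n} \<and>
    monotone_on ?A (\<lambda>s t. (s, t) \<in> strip_less m n S) (<) \<mu> \<and>
    (\<forall>(k, j) \<in> ?A. pos m S K (k, j) = \<mu> (k, j) + j) \<and>
    (\<forall>(k, j) \<in> strip_poset m n S - ?A.
       pos m S K (k, j) = Max ({\<mu> s | s. s \<in> ?A \<and> (s, (k, j)) \<in> strip_less m n S} \<union> {0}) + j)"
    by blast
  fix \<mu>' :: "int \<times> nat \<Rightarrow> nat"
  assume \<mu>': "\<mu>' \<in> ?A \<rightarrow>\<^sub>E {1..n} \<and>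
    monotone_on ?A (\<lambda>s t. (s, t) \<in> strip_less m n S) (<) \<mu>' \<and>
    (\<forall>(k, j) \<in> ?A. pos m S K (k, j) = \<mu>' (k, j) + j) \<and>
    (\<forall>(k, j) \<in> strip_poset m n S - ?A.
       pos m S K (k, j) = Max ({\<mu>' s | s. s \<in> ?A \<and> (s, (k, j)) \<in> strip_less m n S} \<union> {0}) + j)"
  show "\<mu>' = \<mu>"
  proof
    fix s
    show "\<mu>' s = \<mu> s"
    proof (cases "s \<in> ?A")
      case True
      obtain k j where s: "s = (k, j)" by (cases s)
      have "\<forall>(k, j) \<in> ?A. pos m S K (k, j) = \<mu>' (k, j) + j"
        using \<mu>' by (elim conjE)
      with True s have "pos m S K (k, j) = \<mu>' (k, j) + j" by (auto simp del: pos.simps)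
      with \<mu>_eq[OF True] pos_shift[of k j] s show ?thesis by (simp del: pos.simps)
    next
      case False
      have "\<mu>' \<in> ?A \<rightarrow>\<^sub>E {1..n}" using \<mu>' by (rule conjunct1)
      then have "\<mu>' s = undefined" using False by (rule PiE_arb)
      with False show ?thesis by (simp add: \<mu>_def)
    qed
  qed
qed

end

section \<open>Regular strips\<close>

lemma regular_strip_matching:
  assumes strip: "regular_strip m n S" and kekule: "kekule_structure S K"
  obtains l r where "strip_matching m n S K l r"
proof -
  from strip obtain a :: "nat \<Rightarrow> int" and len :: "nat \<Rightarrow> nat" where m: "1 \<le> m"
    and S: "S = (\<Union>k\<in>{1..m}. one_tier_strip (a k) (int k) (len k))"
    and sub: "S \<subseteq> lattice_hexagons" and len: "\<And>k. k \<in> {1..m} \<Longrightarrow> 1 \<le> len k"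
    and step: "\<And>k. k \<in> {1..<m} \<Longrightarrow> \<bar>(a (k + 1) - 1) - (a k - 1)\<bar> = 1 \<and>
      \<bar>(a (k + 1) + 2 * int (len (k + 1)) - 1) - (a k + 2 * int (len k) - 1)\<bar> = 1"
    and ends: "len 1 = n" "len m = n"
    unfolding regular_strip_def by blast
  define l :: "int \<Rightarrow> int" where
    "l k = (if k = 0 then a 1 else if k = int m + 1 then a m else a (nat k) - 1)" for k
  define r :: "int \<Rightarrow> int" where
    "r k = (if k = 0 then a 1 + 2 * int n - 2 else if k = int m + 1 then a m + 2 * int n - 2
      else a (nat k) + 2 * int (len (nat k)) - 1)" for k
  have l_row: "l (int k) = a k - 1" and r_row: "r (int k) = a k + 2 * int (len k) - 1"
    if "k \<in> {1..m}" for k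
    using that by (auto simp: l_def r_def)
  have odd_a: "odd (a k + int k)" if k: "k \<in> {1..m}" for k
  proof -
    have "(a k, int k) \<in> one_tier_strip (a k) (int k) (len k)"
      using len[OF k] unfolding one_tier_strip_def by (force intro: exI[of _ 0])
    then have "(a k, int k) \<in> lattice_hexagons" using S sub k by blast
    then show ?thesis by (simp add: lattice_hexagons_def)
  qed
  have even_ends: "even (l k + k) \<and> even (r k + k)" if k: "0 \<le> k" "k \<le> int m + 1" for k
  proof -
    have "k = 0 \<or> k = int m + 1 \<or> k = int (nat k) \<and> nat k \<in> {1..m}" using k by auto
    then consider "k = 0" | "k = int m + 1" | i where "k = int i" "i \<in> {1..m}" by blast
    then show ?thesis
    proof cases
      case 1 then show ?thesis
        using odd_a[of 1] m by (auto simp: l_def r_def)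
    next
      case 2 then show ?thesis
        using odd_a[of m] m by (auto simp: l_def r_def)
    next
      case 3 then show ?thesis
        using odd_a[of i] l_row[of i] r_row[of i] by auto
    qed
  qed
  have tier: "(x, k) \<in> one_tier_strip (a i) (int i) (len i)
      \<longleftrightarrow> k = int i \<and> l k < x \<and> x < r k \<and> odd (x + k)" if i: "i \<in> {1..m}" for x k i
  proof
    assume "(x, k) \<in> one_tier_strip (a i) (int i) (len i)"
    then show "k = int i \<and> l k < x \<and> x < r k \<and> odd (x + k)"
      using l_row[OF i] r_row[OF i] odd_a[OF i] by (auto simp: one_tier_strip_def)
  next
    assume x: "k = int i \<and> l k < x \<and> x < r k \<and> odd (x + k)"
    then have "even (x - a i)" using odd_a[OF i] by auto
    then obtain q where q: "x - a i = 2 * q" by (elim evenE)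
    moreover have "0 \<le> q" "q < int (len i)" using x q l_row[OF i] r_row[OF i] by auto
    ultimately show "(x, k) \<in> one_tier_strip (a i) (int i) (len i)"
      using x by (auto simp: one_tier_strip_def intro!: exI[of _ "nat q"])
  qed
  have "strip_matching m n S K l r"
  proof
    show "(x, k) \<in> S \<longleftrightarrow> 1 \<le> k \<and> k \<le> int m \<and> l k < x \<and> x < r k \<and> odd (x + k)" for x k
    proof -
      have "(x, k) \<in> S \<longleftrightarrow> (\<exists>i\<in>{1..m}. k = int i) \<and> l k < x \<and> x < r k \<and> odd (x + k)"
        using tier by (auto simp: S)
      moreover have "(\<exists>i\<in>{1..m}. k = int i) \<longleftrightarrow> 1 \<le> k \<and> k \<le> int m"
        by (auto intro!: bexI[of _ "nat k"])
      ultimately show ?thesis by auto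
    qed
    show "l k < r k" if "1 \<le> k" "k \<le> int m" for k
    proof -
      have "nat k \<in> {1..m}" using that by auto
      from len[OF this] that show ?thesis by (auto simp: l_def r_def)
    qed
    show "\<bar>l (k + 1) - l k\<bar> = 1" "\<bar>r (k + 1) - r k\<bar> = 1" if k: "0 \<le> k" "k \<le> int m" for k
    proof -
      have "k = 0 \<or> k = int m \<or> nat k \<in> {1..<m}" using k by auto
      moreover have "nat (k + 1) = nat k + 1" using k by simp
      ultimately show "\<bar>l (k + 1) - l k\<bar> = 1" "\<bar>r (k + 1) - r k\<bar> = 1"
        using k m ends step[of "nat k"] by (auto simp: l_def r_def)
    qed
    show "r 0 - l 0 = 2 * int n - 2" "l 1 < l 0" "r 0 < r 1" "l (int m) < l (int m + 1)"
      "r (int m + 1) < r (int m)"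
      using m ends by (auto simp: l_def r_def)
  qed (use even_ends kekule in auto)
  then show thesis by (rule that)
qed

theorem lemma22:
  fixes m n :: nat and S :: "hexagon set" and K :: "edge set"
  assumes "regular_strip m n S"
    and "kekule_structure S K"
  shows "\<exists>!\<mu> :: int \<times> nat \<Rightarrow> nat.
    \<mu> \<in> sextet_poset m n S K \<rightarrow>\<^sub>E {1..n} \<and>
    monotone_on (sextet_poset m n S K) (\<lambda>s t. (s, t) \<in> strip_less m n S) (<) \<mu> \<and>
    (\<forall>(k, j) \<in> sextet_poset m n S K. pos m S K (k, j) = \<mu> (k, j) + j) \<and>
    (\<forall>(k, j) \<in> strip_poset m n S - sextet_poset m n S K.
       pos m S K (k, j) =
         Max ({\<mu> s | s. s \<in> sextet_poset m n S K \<and> (s, (k, j)) \<in> strip_less m n S} \<union> {0}) + j)"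
proof -
  from assms obtain l r where "strip_matching m n S K l r"
    by (rule regular_strip_matching)
  then interpret strip_matching m n S K l r .
  show ?thesis by (rule unique_order_preserving_map)
qed

end
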